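(* Let $X$ be a Fréchet space and let $T:X\to X$ be a continuous linear operator. The following are equivalent: (i) $T$ is multiply recurrent; (ii) $T$ is $\mathcal{AP}$-recurrent.
   Context: $\mathcal{AP}$ is the family of all subsets of $\mathbb{N}$ that contain arbitrarily long (finite) arithmetic progressions $\{a,a+k,\dots,a+mk\}$ (common difference $k\ge 1$). For $x\in X$ and $U\subseteq X$, $N_T(x,U)=\{n\in\mathbb{N}: T^n x\in U\}$. $T$ is multiply recurrent if for every nonempty open set $U$ and every $m\in\mathbb{N}$ there is $k\ge 1$ such that $U\cap T^{-k}(U)\cap\dots\cap T^{-km}(U)\neq\emptyset$. A vector $x$ is $\mathcal{AP}$-recurrent for $T$ if $N_T(x,U)\in\mathcal{AP}$ for every open set $U$ containing $x$. $T$ is $\mathcal{AP}$-recurrent if the set of $\mathcal{AP}$-recurrent vectors for $T$ is dense in $X$. *)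

theory Defs
  imports "HOL-Analysis.Analysis"
begin

text \<open>
  By the theorem of Gelfand and Mazur, the real and the complex numbers are, up to isometric
  isomorphism, the only instances of the class \<^class>\<open>real_normed_field\<close>, so the scalar type
  below covers exactly the two usual scalar fields.

  Continuity of addition and of negation comes from the class
  \<^class>\<open>topological_ab_group_add\<close>. The metric in \<open>complete_metric\<close> is only required to exist; the
  structure carried by the space is its topology. The Hausdorff property follows from its existence.
\<close>

definition convex_wrt ::
    "('k::real_normed_field \<Rightarrow> 'a::ab_group_add \<Rightarrow> 'a) \<Rightarrow> 'a set \<Rightarrow> bool" where
  "convex_wrt smul C \<longleftrightarrow>
     (\<forall>x\<in>C. \<forall>y\<in>C. \<forall>t::real. 0 \<le> t \<and> t \<le> 1 \<longrightarrow>
        smul (of_real (1 - t)) x + smul (of_real t) y \<in> C)"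

locale frechet_space = vector_space smul
  for smul :: "'k::real_normed_field \<Rightarrow> 'a::topological_ab_group_add \<Rightarrow> 'a" +
  assumes continuous_smul: "continuous_on UNIV (\<lambda>(c, x). smul c x)"
    and locally_convex:
      "\<And>U. open U \<Longrightarrow> 0 \<in> U \<Longrightarrow>
         \<exists>C. open C \<and> 0 \<in> C \<and> C \<subseteq> U \<and> convex_wrt smul C"
    and complete_metric:
      "\<exists>d. Metric_space UNIV d \<and> Metric_space.mcomplete UNIV d \<and>
           Metric_space.mtopology UNIV d = (euclidean :: 'a topology) \<and>
           (\<forall>x y z. d (x + z) (y + z) = d x y)"

definition AP :: "nat set set" where
  "AP = {A. \<forall>m. \<exists>a k. k \<ge> 1 \<and> (\<forall>j\<le>m. a + j * k \<in> A)}"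

definition return_set :: "('a \<Rightarrow> 'a) \<Rightarrow> 'a \<Rightarrow> 'a set \<Rightarrow> nat set" where
  "return_set T x U = {n. (T ^^ n) x \<in> U}"

definition multiply_recurrent :: "('a::topological_space \<Rightarrow> 'a) \<Rightarrow> bool" where
  "multiply_recurrent T \<longleftrightarrow>
     (\<forall>U m. open U \<and> U \<noteq> {} \<longrightarrow>
        (\<exists>k\<ge>1. U \<inter> (\<Inter>j\<in>{1..m}. (T ^^ (k * j)) -` U) \<noteq> {}))"

definition AP_recurrent_vector :: "('a::topological_space \<Rightarrow> 'a) \<Rightarrow> 'a \<Rightarrow> bool" where
  "AP_recurrent_vector T x \<longleftrightarrow> (\<forall>U. open U \<and> x \<in> U \<longrightarrow> return_set T x U \<in> AP)"

definition AP_recurrent :: "('a::topological_space \<Rightarrow> 'a) \<Rightarrow> bool" where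
  "AP_recurrent T \<longleftrightarrow> closure {x. AP_recurrent_vector T x} = UNIV"

end

theory Submission
  imports Defs
begin

text \<open>
  The equivalence is a fact of topological dynamics: it holds for continuous self-maps of completely
  metrizable spaces, and a Frechet space is one of these.

  Suppose that the orbit of \<open>x\<close> visits \<open>U\<close> along a progression \<open>a, a + k, \<dots>, a + m k\<close>. Then the
  point \<open>T\<^sup>a x\<close> lies in \<open>U\<close> together with its images under \<open>T\<^sup>k, \<dots>, T\<^sup>m\<^sup>k\<close>. So a single
  \<open>\<A>\<P>\<close>-recurrent vector in each nonempty open set already makes \<open>T\<close> multiply recurrent.

  Conversely, multiple recurrence yields, in every nonempty open set and at every scale \<open>1/(n + 1)\<close>, a
  point \<open>x\<close> such that \<open>x, T\<^sup>k x, \<dots>, T\<^sup>n\<^sup>k x\<close> lie in one common ball of radius \<open>1/(n + 1)\<close>, for some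
  \<open>k \<ge> 1\<close>. For each \<open>n\<close> the points with this property form an open set, which is therefore dense. By
  the Baire category theorem, so is the intersection of these sets over all \<open>n\<close>. A point of the
  intersection satisfies, for every \<open>n\<close>, that some \<open>k \<ge> 1\<close> brings it back within \<open>2/(n + 1)\<close> of itself
  at the times \<open>0, k, \<dots>, n k\<close>, and hence it is \<open>\<A>\<P>\<close>-recurrent. Countably many conditions suffice
  because one sequence of scales controls the neighbourhoods of all points at once.
\<close>

definition progression_points :: "('a \<Rightarrow> 'a) \<Rightarrow> nat \<Rightarrow> 'a set \<Rightarrow> 'a set" where
  "progression_points T m U = {x. \<exists>k\<ge>1. \<forall>j\<le>m. (T ^^ (k * j)) x \<in> U}"

text \<open>
  The term \<open>j = 0\<close> of the progression encodes that the point itself lies in the open set.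
\<close>

lemma multiply_recurrent_iff_progression_points:
  "multiply_recurrent T \<longleftrightarrow> (\<forall>U m. open U \<and> U \<noteq> {} \<longrightarrow> progression_points T m U \<noteq> {})"
proof -
  have "U \<inter> (\<Inter>j\<in>{1..m}. (T ^^ (k * j)) -` U) = {x. \<forall>j\<le>m. (T ^^ (k * j)) x \<in> U}"
    for k m and U :: "'a set"
  proof -
    have "{..m} = insert 0 {1..m}"
      by auto
    then have "(\<forall>j\<le>m. P j) \<longleftrightarrow> P 0 \<and> (\<forall>j\<in>{1..m}. P j)" for P
      by (metis atMost_iff insert_iff)
    then show ?thesis
      by auto
  qed
  moreover have "progression_points T m U \<noteq> {} \<longleftrightarrow>
      (\<exists>k\<ge>1. {x. \<forall>j\<le>m. (T ^^ (k * j)) x \<in> U} \<noteq> {})" for m U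
    unfolding progression_points_def by blast
  ultimately show ?thesis
    unfolding multiply_recurrent_def by simp
qed

lemma progression_points_mono:
  assumes "U \<subseteq> V" "l \<le> m"
  shows "progression_points T m U \<subseteq> progression_points T l V"
proof
  fix x
  assume "x \<in> progression_points T m U"
  then obtain k where "k \<ge> 1" "\<forall>j\<le>m. (T ^^ (k * j)) x \<in> U"
    unfolding progression_points_def by blast
  then have "\<forall>j\<le>l. (T ^^ (k * j)) x \<in> V"
    using assms order_trans [of _ l m] by blast
  with \<open>k \<ge> 1\<close> show "x \<in> progression_points T l V"
    unfolding progression_points_def by blast
qed

lemma progression_points_subset: "progression_points T m U \<subseteq> U"
proof
  fix x
  assume "x \<in> progression_points T m U"
  then obtain k where "\<forall>j\<le>m. (T ^^ (k * j)) x \<in> U"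
    unfolding progression_points_def by blast
  then have "(T ^^ (k * 0)) x \<in> U"
    by blast
  then show "x \<in> U"
    by simp
qed

lemma continuous_on_funpow:
  fixes T :: "'a::topological_space \<Rightarrow> 'a"
  assumes "continuous_on UNIV T"
  shows "continuous_on UNIV (T ^^ n)"
proof (induction n)
  case (Suc n)
  have "continuous_on UNIV (T \<circ> T ^^ n)"
    by (rule continuous_on_compose [OF Suc continuous_on_subset [OF assms subset_UNIV]])
  then show ?case
    by simp
qed (simp add: id_def)

lemma open_progression_points:
  fixes T :: "'a::topological_space \<Rightarrow> 'a"
  assumes "continuous_on UNIV T" "open U"
  shows "open (progression_points T m U)"
proof -
  have "progression_points T m U = (\<Union>k\<in>{1..}. \<Inter>j\<in>{..m}. (T ^^ (k * j)) -` U)"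
    unfolding progression_points_def by auto
  moreover have "open ((T ^^ n) -` U)" for n
    using continuous_on_funpow [OF assms(1)] assms(2) by (simp add: open_vimage)
  ultimately show ?thesis
    by (simp add: open_INT open_UN)
qed

lemma AP_recurrent_vector_iff:
  "AP_recurrent_vector T x \<longleftrightarrow>
    (\<forall>U m. open U \<and> x \<in> U \<longrightarrow> (\<exists>a k. k \<ge> 1 \<and> (\<forall>j\<le>m. (T ^^ (a + j * k)) x \<in> U)))"
  unfolding AP_recurrent_vector_def AP_def return_set_def mem_Collect_eq by simp

text \<open>
  Progressions starting at time \<open>0\<close> are special progressions. Points whose returns follow them in
  every neighbourhood are the ones that the Baire argument supplies.
\<close>

lemma AP_recurrent_vectorI:
  assumes "\<And>U m. open U \<Longrightarrow> x \<in> U \<Longrightarrow> x \<in> progression_points T m U"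
  shows "AP_recurrent_vector T x"
  unfolding AP_recurrent_vector_iff
proof (intro allI impI)
  fix U m
  assume "open U \<and> x \<in> U"
  then obtain k where "k \<ge> 1" "\<forall>j\<le>m. (T ^^ (k * j)) x \<in> U"
    using assms unfolding progression_points_def by blast
  then show "\<exists>a k. k \<ge> 1 \<and> (\<forall>j\<le>m. (T ^^ (a + j * k)) x \<in> U)"
    by (intro exI [of _ 0] exI [of _ k]) (simp add: mult.commute)
qed

text \<open>
  Moving along the orbit to the first term \<open>a\<close> of the progression turns the returns of an
  \<open>\<A>\<P>\<close>-recurrent vector at the times \<open>a + j k\<close> into returns of \<open>T\<^sup>a x\<close> at the times \<open>j k\<close>.
\<close>

lemma AP_recurrent_imp_multiply_recurrent:
  fixes T :: "'a::topological_space \<Rightarrow> 'a"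
  assumes "AP_recurrent T"
  shows "multiply_recurrent T"
  unfolding multiply_recurrent_iff_progression_points
proof (intro allI impI)
  fix U :: "'a set" and m
  assume U: "open U \<and> U \<noteq> {}"
  have "{x. AP_recurrent_vector T x} \<inter> U \<noteq> {}"
    using assms U open_Int_closure_eq_empty [of U] unfolding AP_recurrent_def by auto
  then obtain x where "AP_recurrent_vector T x" "x \<in> U"
    by blast
  then obtain a k where k: "k \<ge> 1" "\<forall>j\<le>m. (T ^^ (a + j * k)) x \<in> U"
    using U unfolding AP_recurrent_vector_iff by meson
  have "(T ^^ (k * j)) ((T ^^ a) x) = (T ^^ (a + j * k)) x" for j
    by (metis add.commute comp_apply funpow_add mult.commute)
  with k have "(T ^^ a) x \<in> progression_points T m U"
    unfolding progression_points_def by auto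
  then show "progression_points T m U \<noteq> {}"
    by blast
qed

lemma multiply_recurrent_imp_AP_recurrent:
  fixes T :: "'a::topological_space \<Rightarrow> 'a"
  assumes "completely_metrizable_space (euclidean :: 'a topology)"
    and cont: "continuous_on UNIV T"
    and rec: "multiply_recurrent T"
  shows "AP_recurrent T"
proof -
  obtain M d where "Metric_space M d" "Metric_space.mcomplete M d"
    and top: "(euclidean :: 'a topology) = Metric_space.mtopology M d"
    using assms(1) unfolding completely_metrizable_space_def by blast
  then interpret Metric_space M d
    by simp
  have M: "M = UNIV"
    using topspace_mtopology by (simp flip: top)
  have open_ball: "open (mball y r)" for y r
    using openin_mball [of y r] by (simp flip: top)
  \<comment> \<open>The ball is centred at an arbitrary \<open>y\<close> and not at the returning point, so that for each \<open>y\<close>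
      the condition concerns one fixed open set and openness is immediate.\<close>
  define G where "G n = (\<Union>y. progression_points T n (mball y (1 / Suc n)))" for n
  have open_G: "open (G n)" for n
    unfolding G_def by (intro open_UN ballI open_progression_points cont open_ball)
  have dense_G: "closure (G n) = UNIV" for n
  proof -
    have "G n \<inter> W \<noteq> {}" if W: "open W" "W \<noteq> {}" for W
    proof -
      obtain y where "y \<in> W"
        using W by blast
      let ?B = "mball y (1 / Suc n)"
      have "y \<in> ?B"
        unfolding centre_in_mball_iff using M by simp
      with \<open>y \<in> W\<close> have "W \<inter> ?B \<noteq> {}"
        by blast
      with W open_ball obtain x where x: "x \<in> progression_points T n (W \<inter> ?B)"
        using rec unfolding multiply_recurrent_iff_progression_points
        by (meson ex_in_conv open_Int)
      then have "x \<in> G n"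
        using progression_points_mono [of "W \<inter> ?B" ?B n n T] unfolding G_def by blast
      moreover have "x \<in> W"
        using x progression_points_subset [of T n "W \<inter> ?B"] by blast
      ultimately show ?thesis
        by blast
    qed
    then show ?thesis
      using dense_intersects_open [of euclidean "G n"] by simp
  qed
  have "closure (\<Inter>(range G)) = UNIV"
    using Baire_category [of euclidean "range G"] assms(1) open_G dense_G by auto
  moreover have "\<Inter>(range G) \<subseteq> {x. AP_recurrent_vector T x}"
  proof (intro subsetI CollectI AP_recurrent_vectorI)
    fix x U m
    assume x: "x \<in> \<Inter>(range G)" and U: "open U" "x \<in> U"
    then obtain r where r: "r > 0" "mball x r \<subseteq> U"
      using openin_mtopology [of U] by (auto simp flip: top)
    obtain p where p: "1 / real (Suc p) < r / 2"
      using nat_approx_posE [of "r / 2"] \<open>r > 0\<close> by auto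
    \<comment> \<open>One index \<open>n\<close> governs both the scale and the length of the progression, so it has to meet
        both requirements.\<close>
    define n where "n = max m p"
    have "1 / real (Suc n) \<le> 1 / real (Suc p)"
      unfolding n_def by (intro divide_left_mono) auto
    with p have n: "1 / real (Suc n) < r / 2"
      by linarith
    obtain y where y: "x \<in> progression_points T n (mball y (1 / Suc n))"
      using x unfolding G_def by blast
    then have xy: "x \<in> mball y (1 / Suc n)"
      using progression_points_subset [of T n "mball y (1 / Suc n)"] by (rule subsetD [rotated])
    \<comment> \<open>Since \<open>x\<close> lies in the ball around \<open>y\<close>, that ball has all its points within \<open>2 / (n + 1)\<close>
        of \<open>x\<close>.\<close>
    have "mball y (1 / Suc n) \<subseteq> mball x r"
    proof
      fix z
      assume "z \<in> mball y (1 / Suc n)"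
      with xy n have "d y x < r / 2" "d y z < r / 2"
        unfolding in_mball by linarith+
      moreover have "d x z \<le> d y x + d y z"
        using triangle [of x y z] commute [of x y] unfolding M by simp
      ultimately have "d x z < r"
        by linarith
      then show "z \<in> mball x r"
        unfolding in_mball using M by blast
    qed
    with r have "mball y (1 / Suc n) \<subseteq> U"
      by blast
    then show "x \<in> progression_points T m U"
      using y progression_points_mono [of "mball y (1 / Suc n)" U m n T] max.cobounded1 [of m p]
      unfolding n_def by blast
  qed
  ultimately show ?thesis
    using closure_mono [of "\<Inter>(range G)"] unfolding AP_recurrent_def by blast
qed

theorem proposition2p2:
  fixes smul :: "'k::real_normed_field \<Rightarrow> 'a::topological_ab_group_add \<Rightarrow> 'a"
    and T :: "'a \<Rightarrow> 'a"
  assumes "frechet_space smul"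
    and "Vector_Spaces.linear smul smul T"
    and "continuous_on UNIV T"
  shows "multiply_recurrent T \<longleftrightarrow> AP_recurrent T"
proof -
  have "completely_metrizable_space (euclidean :: 'a topology)"
    using frechet_space.complete_metric [OF assms(1)]
    unfolding completely_metrizable_space_def by metis
  then show ?thesis
    using multiply_recurrent_imp_AP_recurrent AP_recurrent_imp_multiply_recurrent assms(3) by blast
qed

end
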